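(* Let $[a,b,c]$ be a primitive Pythagorean triple with $a$ odd, and let $$r_1=\tfrac12(a+b-c),\quad r_2=\tfrac12(a-b+c),\quad r_3=\tfrac12(-a+b+c),\quad r_4=\tfrac12(a+b+c).$$ Let $q/p$ be the common value, written in lowest terms with $p,q$ positive integers, of the equal fractions $$\frac{r_1}{r_2}=\frac{r_3}{r_4}=\frac{b}{a+c}=\frac{c-a}{b},$$ and let $q'/p'$ be the common value, written in lowest terms with $p',q'$ positive integers, of the equal fractions $$\frac{r_1}{r_3}=\frac{r_2}{r_4}=\frac{a}{b+c}=\frac{c-b}{a}.$$ Then the following hold: $$r_1=qq',\quad r_2=pq',\quad r_3=qp',\quad r_4=pp';$$ $$p-q=q',\quad p+q=p',\quad \tfrac12(p'-q')=q,\quad \tfrac12(p'+q')=p;$$ $$[a,b,c]=[p^2-q^2,\;2pq,\;p^2+q^2];$$ $$[b,a,c]=[\tfrac12(p'^2-q'^2),\;p'q',\;\tfrac12(p'^2+q'^2)];$$ $$[a,b,c]=[p'q',\;2pq,\;pq'+qp'];$$ $$[a,b,c]=[p'q',\;2pq,\;pp'-qq'].$$ Moreover, $q/p$ and $q'/p'$ are the half-angle tangents of the right triangle with legs $a,b$ and hypotenuse $c$.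
   Context: A Pythagorean triple $[a,b,c]$ consists of positive integers with $a^2+b^2=c^2$; it is primitive if $\gcd(a,b,c)=1$. Convention: in a primitive triple the first leg $a$ is odd. The numbers $r_1,r_2,r_3,r_4$ (the "radii" of the triple) are then positive integers. The half-angle tangents of a right triangle are the tangents of half of each of its two acute angles. *)

theory Defs
  imports "HOL-Analysis.Analysis"
begin

definition pythagorean_triple :: "int \<Rightarrow> int \<Rightarrow> int \<Rightarrow> bool" where
  "pythagorean_triple a b c \<longleftrightarrow> a > 0 \<and> b > 0 \<and> c > 0 \<and> a\<^sup>2 + b\<^sup>2 = c\<^sup>2"

definition primitive_pythagorean_triple :: "int \<Rightarrow> int \<Rightarrow> int \<Rightarrow> bool" where
  "primitive_pythagorean_triple a b c \<longleftrightarrow> pythagorean_triple a b c \<and> Gcd {a, b, c} = 1"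

text \<open>The halves are taken in the reals, so there is no rounding; that the radii of a
  primitive triple are integers is not built into the definitions.\<close>

definition radius1 :: "int \<Rightarrow> int \<Rightarrow> int \<Rightarrow> real" where
  "radius1 a b c = 1/2 * of_int (a + b - c)"

definition radius2 :: "int \<Rightarrow> int \<Rightarrow> int \<Rightarrow> real" where
  "radius2 a b c = 1/2 * of_int (a - b + c)"

definition radius3 :: "int \<Rightarrow> int \<Rightarrow> int \<Rightarrow> real" where
  "radius3 a b c = 1/2 * of_int (- a + b + c)"

definition radius4 :: "int \<Rightarrow> int \<Rightarrow> int \<Rightarrow> real" where
  "radius4 a b c = 1/2 * of_int (a + b + c)"

text \<open>The unoriented angle at the vertex \<open>Y\<close> between the rays towards \<open>X\<close> and \<open>Z\<close>.\<close>

definition vertex_angle :: "'a::real_inner \<Rightarrow> 'a \<Rightarrow> 'a \<Rightarrow> real" where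
  "vertex_angle X Y Z = arccos (((X - Y) \<bullet> (Z - Y)) / (norm (X - Y) * norm (Z - Y)))"

text \<open>A nondegenerate triangle \<open>A B C\<close> with the right angle at \<open>C\<close>, where the leg \<open>a\<close> lies
  opposite \<open>A\<close>, the leg \<open>b\<close> opposite \<open>B\<close>, and \<open>c\<close> is the hypotenuse.\<close>

definition right_triangle_with_sides ::
    "'a::real_inner \<Rightarrow> 'a \<Rightarrow> 'a \<Rightarrow> real \<Rightarrow> real \<Rightarrow> real \<Rightarrow> bool" where
  "right_triangle_with_sides A B C a b c \<longleftrightarrow>
     A \<noteq> C \<and> B \<noteq> C \<and> vertex_angle A C B = pi / 2 \<and>
     dist B C = a \<and> dist A C = b \<and> dist A B = c"

text \<open>For a right angle at \<open>C\<close>, the two acute angles are those at \<open>A\<close> and \<open>B\<close>.\<close>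

definition half_angle_tangents :: "'a::real_inner \<Rightarrow> 'a \<Rightarrow> 'a \<Rightarrow> real set" where
  "half_angle_tangents A B C = {tan (vertex_angle C A B / 2), tan (vertex_angle C B A / 2)}"

end

theory Submission
  imports Defs
begin

text \<open>Cross-multiplying the fractions that define \<open>q/p\<close> gives \<open>b = p q m\<close>,
  \<open>c + a = p\<^sup>2 m\<close>, \<open>c - a = q\<^sup>2 m\<close> for some \<open>m\<close>. Primitivity forces \<open>m\<close> to divide 2, and
  \<open>m = 1\<close> would make \<open>p\<close>, \<open>q\<close> both odd, hence \<open>2 a = p\<^sup>2 - q\<^sup>2\<close> divisible by 8. Then
  \<open>q'/p' = a/(b + c) = (p - q)/(p + q)\<close>, which is already in lowest terms as \<open>p - q\<close> is odd.\<close>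

lemma primitive_pythagorean_triple_parametrization:
  fixes a b c p q :: int
  assumes prim: "primitive_pythagorean_triple a b c" and "odd a"
    and pos: "p > 0" "q > 0" and cop: "coprime q p" and frac: "q * (a + c) = p * b"
  shows "a = p\<^sup>2 - q\<^sup>2" "b = 2 * p * q" "c = p\<^sup>2 + q\<^sup>2"
proof -
  have abc: "a > 0" "b > 0" "c > 0" "a\<^sup>2 + b\<^sup>2 = c\<^sup>2" "Gcd {a, b, c} = 1"
    using prim by (auto simp: primitive_pythagorean_triple_def pythagorean_triple_def)
  have "q dvd p * b"
    using frac by (metis dvd_triv_left)
  then obtain k where k: "b = q * k"
    using cop by (auto simp: coprime_dvd_mult_right_iff elim: dvdE)
  have sum: "a + c = p * k"
    using frac pos k by (simp add: mult.left_commute)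
  have "k > 0"
    using abc(2) pos k by (simp add: zero_less_mult_iff)
  \<comment> \<open>Both sides equal \<open>b\<^sup>2\<close>: the left one is
    \<open>(c - a) * (c + a)\<close>, the right one \<open>(q * k)\<^sup>2\<close>. Cancelling
    \<open>k\<close> leaves a relation to which coprimality applies a second time, now to split
    \<open>p\<close> off \<open>k\<close>.\<close>
  have "k * ((c - a) * p) = k * (q * (q * k))"
    using abc(4) sum k by algebra
  then have diff: "(c - a) * p = q * (q * k)"
    using \<open>k > 0\<close> by simp
  then have "p dvd q * (q * k)"
    by (metis dvd_triv_right)
  then obtain m where m: "k = p * m"
    using cop by (auto simp: coprime_dvd_mult_right_iff coprime_commute elim: dvdE)
  have m_eqs: "b = p * q * m" "a + c = p\<^sup>2 * m" "c - a = q\<^sup>2 * m"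
    using k sum diff m pos by (auto simp: power2_eq_square)
  have "m > 0"
    using \<open>k > 0\<close> m pos by (simp add: zero_less_mult_iff)
  have "2 * a = (p\<^sup>2 - q\<^sup>2) * m" "2 * c = (p\<^sup>2 + q\<^sup>2) * m"
    using m_eqs by (simp_all add: algebra_simps)
  then have "m dvd 2 * a" "m dvd 2 * b" "m dvd 2 * c"
    using m_eqs(1) by simp_all
  then have "m dvd gcd (2 * a) (gcd (2 * b) (2 * c))"
    by simp
  also have "\<dots> = 2 * gcd a (gcd b c)"
    by (simp add: gcd_mult_left)
  also have "\<dots> = 2"
    using abc(5) by simp
  finally have "m = 1 \<or> m = 2"
    using \<open>m > 0\<close> zdvd_imp_le[of m 2] by auto
  moreover have "m \<noteq> 1"
  proof
    assume "m = 1"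
    then have eq: "2 * a = p\<^sup>2 - q\<^sup>2"
      using m_eqs by simp
    then have "even (p\<^sup>2 - q\<^sup>2)"
      by (metis dvd_triv_left)
    moreover have "odd p \<or> odd q"
      using cop coprime_common_divisor[of q p 2] by auto
    ultimately have "odd p" "odd q"
      by auto
    then obtain i j where "p = 2 * i + 1" "q = 2 * j + 1"
      by (auto elim!: oddE)
    \<comment> \<open>A difference of two odd squares is a multiple of 4, which already makes
      \<open>a\<close> even.\<close>
    then have "a = 2 * (i * (i + 1) - j * (j + 1))"
      using eq by (simp add: power2_eq_square algebra_simps)
    with \<open>odd a\<close> show False
      by simp
  qed
  ultimately have "m = 2"
    by blast
  then show "a = p\<^sup>2 - q\<^sup>2" "b = 2 * p * q" "c = p\<^sup>2 + q\<^sup>2"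
    using m_eqs by simp_all
qed

text \<open>Uniqueness of lowest terms, used to read off \<open>q'\<close> and \<open>p'\<close>
  separately once the value of their quotient is known.\<close>

lemma coprime_fractions_eq_iff:
  fixes p q r s :: int
  assumes "p > 0" "q > 0" "r > 0" "s > 0" "coprime q p" "coprime s r" "q * r = s * p"
  shows "q = s" "p = r"
proof -
  have "\<bar>q\<bar> = \<bar>s\<bar> \<and> \<bar>r\<bar> = \<bar>p\<bar>"
    using assms by (intro coprime_crossproduct_int[THEN iffD1]) (auto simp: coprime_commute)
  then show "q = s" "p = r"
    using assms by auto
qed

text \<open>The law of cosines, from the polarization identity. It reduces angles to side lengths,
  so the triangle never needs coordinates.\<close>

lemma vertex_angle_sides:
  "vertex_angle X Y Z =
    arccos (((dist X Y)\<^sup>2 + (dist Z Y)\<^sup>2 - (dist X Z)\<^sup>2) / (2 * dist X Y * dist Z Y))"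
proof -
  have inner_eq: "(X - Y) \<bullet> (Z - Y) = ((dist X Y)\<^sup>2 + (dist Z Y)\<^sup>2 - (dist X Z)\<^sup>2) / 2"
    using dot_norm_neg[of "X - Y" "Z - Y"] by (simp add: dist_norm)
  show ?thesis
    unfolding vertex_angle_def inner_eq by (simp add: dist_norm mult.assoc)
qed

text \<open>With cosine \<open>x / z\<close> and sine \<open>y / z\<close>, this is the identity
  tan(t/2) = sin t / (1 + cos t).\<close>

lemma tan_half_arccos_pythagorean:
  fixes x y z :: real
  assumes "x > 0" "y > 0" "z > 0" "x\<^sup>2 + y\<^sup>2 = z\<^sup>2"
  shows "tan (arccos (x / z) / 2) = y / (x + z)"
proof -
  have "x\<^sup>2 \<le> z\<^sup>2"
    using assms(4) zero_le_power2[of y] by linarith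
  then have "x \<le> z"
    using assms(3) by (simp add: power2_le_iff_abs_le)
  then have bounds: "-1 \<le> x / z" "x / z \<le> 1"
    using assms by (auto intro: order_trans[of _ 0])
  have "1 - (x / z)\<^sup>2 = (y / z)\<^sup>2"
    using assms by (simp add: field_simps)
  then have "sin (arccos (x / z)) = y / z"
    using bounds assms by (simp add: sin_arccos)
  then have "tan (arccos (x / z) / 2) = (y / z) / (x / z + 1)"
    using bounds by (simp add: tan_half cos_arccos)
  also have "\<dots> = y / (x + z)"
    using assms by (simp add: field_simps)
  finally show ?thesis .
qed

lemma half_angle_tangents_right_triangle:
  assumes tri: "right_triangle_with_sides A B C a b c"
    and pos: "a > 0" "b > 0" "c > 0" and pyth: "a\<^sup>2 + b\<^sup>2 = c\<^sup>2"
  shows "half_angle_tangents A B C = {b / (a + c), a / (b + c)}"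
proof -
  have d: "dist B C = a" "dist C B = a" "dist A C = b" "dist C A = b"
    "dist A B = c" "dist B A = c"
    using tri by (auto simp: right_triangle_with_sides_def dist_commute)
  \<comment> \<open>By the Pythagorean relation the numerators in the law of cosines collapse, for
    instance \<open>b\<^sup>2 + c\<^sup>2 - a\<^sup>2 = 2 * b\<^sup>2\<close> at
    \<open>A\<close>.\<close>
  have "vertex_angle C A B = arccos (b / c)" "vertex_angle C B A = arccos (a / c)"
    using pos pyth[symmetric] by (simp_all add: vertex_angle_sides d power2_eq_square)
  then show ?thesis
    using tan_half_arccos_pythagorean[of a b c] tan_half_arccos_pythagorean[of b a c] pos pyth
    by (auto simp: half_angle_tangents_def add.commute)
qed

theorem theorem2:
  fixes a b c p q p' q' :: int
    and r1 r2 r3 r4 :: real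
  assumes "primitive_pythagorean_triple a b c"
    and "odd a"
    and "r1 = radius1 a b c"
    and "r2 = radius2 a b c"
    and "r3 = radius3 a b c"
    and "r4 = radius4 a b c"
    and "p > 0" and "q > 0" and "coprime q p" and "of_int q / of_int p = r1 / r2"
    and "p' > 0" and "q' > 0" and "coprime q' p'" and "of_int q' / of_int p' = r1 / r3"
  shows
    "(r1 / r2 = r3 / r4 \<and>
      r3 / r4 = of_int b / of_int (a + c) \<and>
      (of_int b / of_int (a + c) :: real) = of_int (c - a) / of_int b)
   \<and> (r1 / r3 = r2 / r4 \<and>
      r2 / r4 = of_int a / of_int (b + c) \<and>
      (of_int a / of_int (b + c) :: real) = of_int (c - b) / of_int a)
   \<and> (r1 = of_int (q * q') \<and> r2 = of_int (p * q') \<and>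
      r3 = of_int (q * p') \<and> r4 = of_int (p * p'))
   \<and> (p - q = q' \<and> p + q = p' \<and>
      1/2 * real_of_int (p' - q') = of_int q \<and> 1/2 * real_of_int (p' + q') = of_int p)
   \<and> (a, b, c) = (p\<^sup>2 - q\<^sup>2, 2 * p * q, p\<^sup>2 + q\<^sup>2)
   \<and> (real_of_int b, real_of_int a, real_of_int c) =
       (1/2 * of_int (p'\<^sup>2 - q'\<^sup>2), of_int (p' * q'), 1/2 * of_int (p'\<^sup>2 + q'\<^sup>2))
   \<and> (a, b, c) = (p' * q', 2 * p * q, p * q' + q * p')
   \<and> (a, b, c) = (p' * q', 2 * p * q, p * p' - q * q')
   \<and> (\<forall>A B C :: real ^ 2.
        right_triangle_with_sides A B C (of_int a) (of_int b) (of_int c) \<longrightarrow>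
        {of_int q / of_int p, of_int q' / of_int p'} = half_angle_tangents A B C)"
proof -
  have abc: "a > 0" "b > 0" "c > 0" "a\<^sup>2 + b\<^sup>2 = c\<^sup>2"
    using assms(1) by (auto simp: primitive_pythagorean_triple_def pythagorean_triple_def)
  define x y z where "x = real_of_int a" and "y = real_of_int b" and "z = real_of_int c"
  note xyz_defs = x_def y_def z_def
  have xyz: "x > 0" "y > 0" "z > 0" "x\<^sup>2 + y\<^sup>2 = z\<^sup>2"
    using abc unfolding xyz_defs by (simp_all flip: of_int_power of_int_add)
  have "x < z" "y < z"
    using xyz by (auto intro!: power2_less_imp_less[where y = z] simp flip: xyz(4))
  have r: "r1 = (x + y - z) / 2" "r2 = (x - y + z) / 2"
    "r3 = (- x + y + z) / 2" "r4 = (x + y + z) / 2"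
    using assms(3-6) by (simp_all add: radius1_def radius2_def radius3_def radius4_def xyz_defs)
  have r_pos: "r2 > 0" "r3 > 0" "r4 > 0"
    using r xyz \<open>x < z\<close> \<open>y < z\<close> by simp_all
  \<comment> \<open>The chains of fractions in cross-multiplied form, each a consequence of
    \<open>x\<^sup>2 + y\<^sup>2 = z\<^sup>2\<close>. For example, \<open>r1 * r4\<close> and
    \<open>r3 * r2\<close> both equal the area \<open>x * y / 2\<close>.\<close>
  have "r1 * r4 = r3 * r2" "r3 * (x + z) = y * r4" "y * y = (z - x) * (x + z)"
    "r2 * (y + z) = x * r4" "x * x = (z - y) * (y + z)"
    unfolding r using xyz(4) by (simp_all add: field_simps power2_eq_square)
  then have fracs: "r1 / r2 = r3 / r4" "r3 / r4 = y / (x + z)" "y / (x + z) = (z - x) / y"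
    "r1 / r3 = r2 / r4" "r2 / r4 = x / (y + z)" "x / (y + z) = (z - y) / x"
    using r_pos xyz by (simp_all add: frac_eq_eq mult.commute)

  have q_over_p: "of_int q / of_int p = y / (x + z)"
    using assms(10) fracs by simp
  then have "of_int q * (x + z) = of_int p * y"
    using assms(7) xyz by (simp add: field_simps)
  then have "q * (a + c) = p * b"
    unfolding xyz_defs by (simp flip: of_int_add of_int_mult)
  note param = primitive_pythagorean_triple_parametrization[OF assms(1,2,7,8,9) this]

  have q'_over_p': "of_int q' / of_int p' = x / (y + z)"
    using assms(14) fracs by simp
  then have "of_int q' * (y + z) = of_int p' * x"
    using assms(11) xyz by (simp add: field_simps)
  then have "q' * (b + c) = p' * a"
    unfolding xyz_defs by (simp flip: of_int_add of_int_mult)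
  \<comment> \<open>In terms of \<open>p\<close> and \<open>q\<close>, \<open>b + c\<close> is
    \<open>(p + q)\<^sup>2\<close> and \<open>a\<close> is \<open>(p - q) * (p + q)\<close>, so a
    factor \<open>p + q\<close> cancels.\<close>
  then have "(p + q) * (q' * (p + q)) = (p + q) * ((p - q) * p')"
    unfolding param by (simp add: power2_eq_square algebra_simps)
  then have cross: "q' * (p + q) = (p - q) * p'"
    using assms(7,8) by simp
  have "p - q > 0"
    using abc(1) param(1) assms(7,8) by (simp add: power2_less_imp_less)
  have "odd (p - q)"
    using assms(2) unfolding param(1) by simp
  \<comment> \<open>Since \<open>p + q = (p - q) + 2 * q\<close>, a common divisor of
    \<open>p - q\<close> and \<open>p + q\<close> divides \<open>2 * q\<close>; but
    \<open>p - q\<close> is odd and coprime to \<open>q\<close>.\<close>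
  have "coprime (p - q) (p + q)"
  proof -
    have "coprime (p - q) q"
      using assms(9) by (metis coprime_commute diff_add_cancel gcd_add1 coprime_iff_gcd_eq_1)
    moreover have "coprime (p - q) 2"
      using \<open>odd (p - q)\<close> by simp
    ultimately have "coprime (p - q) (2 * q)"
      by simp
    moreover have "gcd (p - q) (p + q) = gcd (p - q) (2 * q)"
      using gcd_add2[of "p - q" "2 * q"] by (simp add: algebra_simps)
    ultimately show ?thesis
      by (simp add: coprime_iff_gcd_eq_1)
  qed
  then have q': "q' = p - q" and p': "p' = p + q"
    using coprime_fractions_eq_iff[of p' q' "p + q" "p - q"] cross assms(7,8,11-13) \<open>p - q > 0\<close>
    by simp_all

  have tangents: "{of_int q / of_int p, of_int q' / of_int p'} = half_angle_tangents A B C"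
    if "right_triangle_with_sides A B C x y z" for A B C :: "real ^ 2"
    using half_angle_tangents_right_triangle[OF that xyz] q_over_p q'_over_p' by simp
  \<comment> \<open>Integrality of the radii appears here: \<open>a + b - c\<close> becomes
    \<open>2 * q * (p - q)\<close>, and the other three sums likewise have a factor 2 that absorbs
    the half.\<close>
  have radii: "r1 = of_int (q * q')" "r2 = of_int (p * q')"
    "r3 = of_int (q * p')" "r4 = of_int (p * p')"
    unfolding r xyz_defs param q' p' by (simp_all add: power2_eq_square field_simps)
  have triples: "(a, b, c) = (p' * q', 2 * p * q, p * q' + q * p')"
    "(a, b, c) = (p' * q', 2 * p * q, p * p' - q * q')"
    "(y, x, z) =
       (1/2 * of_int (p'\<^sup>2 - q'\<^sup>2), of_int (p' * q'), 1/2 * of_int (p'\<^sup>2 + q'\<^sup>2))"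
    unfolding xyz_defs param q' p' by (simp_all add: power2_eq_square algebra_simps)
  have halves: "1/2 * real_of_int (p' - q') = of_int q" "1/2 * real_of_int (p' + q') = of_int p"
    unfolding q' p' by simp_all
  have "(a, b, c) = (p\<^sup>2 - q\<^sup>2, 2 * p * q, p\<^sup>2 + q\<^sup>2)"
    using param by blast
  then show ?thesis
    using fracs radii q'[symmetric] p'[symmetric] halves triples tangents
    unfolding xyz_defs of_int_add of_int_diff by blast
qed

end
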